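(* Let $\beta\ge 0$ and $y\in\mathbb R$, and let $\tilde d^*\in\mathcal D$ be an optimal policy of the pseudo mean-variance problem $\min_{d\in\mathcal D}\{\beta\tilde\sigma^d(y)-\mu^d\}$. If a policy $d\in\mathcal D$ satisfies $\mu^d\in\big[\,y-|y-\mu^{\tilde d^*}|,\ y+|y-\mu^{\tilde d^*}|\,\big]$, then $$\beta\sigma^{\tilde d^*}-\mu^{\tilde d^*}\le\beta\sigma^d-\mu^d.$$
   Context: MDP setting. $\mathcal S=\{1,\dots,S\}$ is a finite state space, $\mathcal A$ is a finite nonempty action space, $p(j|i,a)$ is the probability of moving from state $i$ to state $j$ under action $a$, and $r(i,a)\in\mathbb R$ is the reward. $\mathcal D$ is the (finite) set of stationary deterministic policies $d:\mathcal S\to\mathcal A$. For $d\in\mathcal D$, $\bm P^d$ is the $S\times S$ transition matrix with entries $p(j|i,d(i))$. Standing assumption: for every $d\in\mathcal D$ the Markov chain with matrix $\bm P^d$ is a unichain (a single recurrent class plus possibly transient states), so it has a unique stationary distribution $\bm\pi^d=(\pi^d(i))_{i\in\mathcal S}$, with $\bm\pi^d\bm P^d=\bm\pi^d$ and $\sum_i\pi^d(i)=1$. Long-run mean: $\mu^d=\sum_{i\in\mathcal S}\pi^d(i)\,r(i,d(i))$. Long-run (steady-state) variance: $\sigma^d=\sum_{i\in\mathcal S}\pi^d(i)\,(r(i,d(i))-\mu^d)^2$ (note that $\sigma^d$ denotes the variance itself). Pseudo variance with pseudo mean $y\in\mathbb R$: $\tilde\sigma^d(y)=\sum_{i\in\mathcal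 S}\pi^d(i)\,(r(i,d(i))-y)^2$. *)

theory Defs
  imports "HOL-Analysis.Analysis" "HOL-Probability.Probability_Mass_Function"
begin

section \<open>Finite Markov chains\<close>

text \<open>Row \<open>i\<close>, column \<open>j\<close> of a transition matrix is the probability of moving from
  \<open>i\<close> to \<open>j\<close>; distributions are row vectors.\<close>

definition accessible :: "real ^ 's ^ 's \<Rightarrow> 's::finite \<Rightarrow> 's \<Rightarrow> bool" where
  "accessible P i j \<longleftrightarrow> (i, j) \<in> {(k, l). P $ k $ l > 0}\<^sup>*"

text \<open>The usual definition of recurrence for a finite chain: \<open>i\<close> can be reached again from
  every state to which the chain can move from \<open>i\<close>. All other states are transient.\<close>

definition recurrent :: "real ^ 's ^ 's \<Rightarrow> 's::finite \<Rightarrow> bool" where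
  "recurrent P i \<longleftrightarrow> (\<forall>j. accessible P i j \<longrightarrow> accessible P j i)"

definition recurrent_class :: "real ^ 's ^ 's \<Rightarrow> 's::finite set \<Rightarrow> bool" where
  "recurrent_class P C \<longleftrightarrow>
     (\<exists>i. recurrent P i \<and> C = {j. accessible P i j \<and> accessible P j i})"

definition unichain :: "real ^ 's ^ 's::finite \<Rightarrow> bool" where
  "unichain P \<longleftrightarrow> (\<exists>!C. recurrent_class P C)"

definition stationary :: "real ^ 's ^ 's \<Rightarrow> real ^ 's::finite \<Rightarrow> bool" where
  "stationary P v \<longleftrightarrow> (\<forall>i. v $ i \<ge> 0) \<and> (\<Sum>i\<in>UNIV. v $ i) = 1 \<and> v v* P = v"

text \<open>Only meaningful if there is exactly one stationary distribution, as there is for the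
  stochastic matrix of a unichain.\<close>

definition stationary_dist :: "real ^ 's ^ 's \<Rightarrow> real ^ 's::finite" where
  "stationary_dist P = (THE v. stationary P v)"

section \<open>Markov decision processes\<close>

text \<open>The transition kernel is \<open>p\<close>, with \<open>pmf (p i a) j\<close> for \<open>p(j|i,a)\<close>. A stationary
  deterministic policy is an arbitrary function from states to actions; the two types are finite,
  hence so is the set of policies.\<close>

definition trans_matrix ::
    "('s \<Rightarrow> 'a \<Rightarrow> 's pmf) \<Rightarrow> ('s \<Rightarrow> 'a::finite) \<Rightarrow> real ^ 's ^ 's::finite" where
  "trans_matrix p d = (\<chi> i j. pmf (p i (d i)) j)"

definition steady_state ::
    "('s \<Rightarrow> 'a \<Rightarrow> 's pmf) \<Rightarrow> ('s \<Rightarrow> 'a::finite) \<Rightarrow> 's::finite \<Rightarrow> real" where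
  "steady_state p d i = stationary_dist (trans_matrix p d) $ i"

definition long_run_mean ::
    "('s \<Rightarrow> 'a \<Rightarrow> 's pmf) \<Rightarrow> ('s \<Rightarrow> 'a \<Rightarrow> real) \<Rightarrow> ('s::finite \<Rightarrow> 'a::finite) \<Rightarrow> real" where
  "long_run_mean p r d = (\<Sum>i\<in>UNIV. steady_state p d i * r i (d i))"

definition long_run_variance ::
    "('s \<Rightarrow> 'a \<Rightarrow> 's pmf) \<Rightarrow> ('s \<Rightarrow> 'a \<Rightarrow> real) \<Rightarrow> ('s::finite \<Rightarrow> 'a::finite) \<Rightarrow> real" where
  "long_run_variance p r d =
     (\<Sum>i\<in>UNIV. steady_state p d i * (r i (d i) - long_run_mean p r d)\<^sup>2)"

definition pseudo_variance ::
    "('s \<Rightarrow> 'a \<Rightarrow> 's pmf) \<Rightarrow> ('s \<Rightarrow> 'a \<Rightarrow> real) \<Rightarrow> real \<Rightarrow> ('s::finite \<Rightarrow> 'a::finite) \<Rightarrow> real" where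
  "pseudo_variance p r y d = (\<Sum>i\<in>UNIV. steady_state p d i * (r i (d i) - y)\<^sup>2)"

end

theory Submission
  imports Defs
begin

text \<open>For a probability vector, the second moment about \<open>y\<close> is the variance plus the squared
  distance from the mean to \<open>y\<close>. Hence the objective of the pseudo problem at a policy exceeds
  its mean-variance objective by \<open>\<beta>\<close> times the squared distance from its mean to \<open>y\<close>. The
  hypothesis on \<open>d\<close> says that this excess is at most as large for \<open>d\<close> as for the optimal
  policy; subtracting the excesses from the inequality that expresses optimality in the pseudo
  problem can therefore only widen the gap.

  What has to be supplied is that \<^const>\<open>steady_state\<close> really is a probability vector, that is,
  that the chain of a policy has exactly one stationary distribution. Existence is Brouwer's
  fixed point theorem on the probability simplex (\<open>stationary_exists\<close>). For uniqueness, the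
  difference of two stationary distributions is an invariant signed vector with sum zero. If it
  is nonzero, it takes both signs; since the positive part of an invariant vector is again
  invariant, the states of either sign form a set that the chain cannot leave, and each of these
  two disjoint sets contains a recurrent class (\<open>recurrent_class_where_invariant_positive\<close>),
  which a unichain does not allow.\<close>

section \<open>Invariant vectors of a stochastic matrix\<close>

definition row_stochastic :: "real ^ 's ^ 's::finite \<Rightarrow> bool" where
  "row_stochastic P \<longleftrightarrow> (\<forall>i j. P $ i $ j \<ge> 0) \<and> (\<forall>i. (\<Sum>j\<in>UNIV. P $ i $ j) = 1)"

lemma row_stochastic_nonneg: "row_stochastic P \<Longrightarrow> P $ i $ j \<ge> 0"
  by (simp add: row_stochastic_def)

lemma row_stochastic_trans_matrix: "row_stochastic (trans_matrix p d)"
  by (simp add: row_stochastic_def trans_matrix_def sum_pmf_eq_1)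

lemma vector_matrix_mult_nth:
  fixes P :: "real ^ 'm ^ 'n::finite"
  shows "(u v* P) $ j = (\<Sum>i\<in>UNIV. P $ i $ j * u $ i)"
  by (simp add: vector_matrix_mult_def mult.commute)

lemma sum_row_stochastic_mult:
  fixes P :: "real ^ 's ^ 's::finite"
  assumes "row_stochastic P"
  shows "(\<Sum>j\<in>UNIV. (u v* P) $ j) = (\<Sum>i\<in>UNIV. u $ i)"
proof -
  have "(\<Sum>j\<in>UNIV. (u v* P) $ j) = (\<Sum>i\<in>UNIV. \<Sum>j\<in>UNIV. P $ i $ j * u $ i)"
    unfolding vector_matrix_mult_nth by (rule sum.swap)
  also have "\<dots> = (\<Sum>i\<in>UNIV. u $ i)"
    using assms by (simp add: row_stochastic_def flip: sum_distrib_right)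
  finally show ?thesis .
qed

text \<open>Mass cannot be created: the image of the positive part dominates the positive part of the
  image, which here is the positive part itself, and the two have the same total. So they agree
  in every coordinate.\<close>

lemma positive_part_invariant:
  fixes P :: "real ^ 's ^ 's::finite"
  assumes P: "row_stochastic P" and inv: "z v* P = z"
  shows "(\<chi> i. max 0 (z $ i)) v* P = (\<chi> i. max 0 (z $ i))"
proof -
  define u where "u = (\<chi> i. max 0 (z $ i))"
  have dom: "u $ j \<le> (u v* P) $ j" for j
  proof -
    have "z $ j = (\<Sum>i\<in>UNIV. P $ i $ j * z $ i)"
      using inv by (metis vector_matrix_mult_nth)
    also have "\<dots> \<le> (u v* P) $ j"
      unfolding vector_matrix_mult_nth
      by (intro sum_mono mult_left_mono) (auto simp: u_def row_stochastic_nonneg[OF P])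
    finally have "z $ j \<le> (u v* P) $ j" .
    moreover have "0 \<le> (u v* P) $ j"
      unfolding vector_matrix_mult_nth
      by (intro sum_nonneg mult_nonneg_nonneg) (auto simp: u_def row_stochastic_nonneg[OF P])
    ultimately show ?thesis by (simp add: u_def)
  qed
  have "(\<Sum>j\<in>UNIV. (u v* P) $ j - u $ j) = 0"
    by (simp add: sum_subtractf sum_row_stochastic_mult[OF P])
  then have "(u v* P) $ j - u $ j = 0" for j
    using dom by (subst (asm) sum_nonneg_eq_0_iff) auto
  then have "u v* P = u" by (simp add: vec_eq_iff)
  then show ?thesis by (simp add: u_def)
qed

text \<open>In \<open>z\<close> itself the inflow into \<open>j\<close> from states of positive mass may be cancelled by
  negative mass; for the positive part, which is invariant as well, there is nothing to cancel
  it.\<close>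

lemma invariant_positive_step:
  fixes P :: "real ^ 's ^ 's::finite"
  assumes P: "row_stochastic P" and inv: "z v* P = z"
    and i: "z $ i > 0" and ij: "P $ i $ j > 0"
  shows "z $ j > 0"
proof -
  define u where "u = (\<chi> i. max 0 (z $ i))"
  have "0 < P $ i $ j * u $ i" using i ij by (simp add: u_def)
  also have "\<dots> \<le> (\<Sum>k\<in>UNIV. P $ k $ j * u $ k)"
    by (rule member_le_sum) (auto simp: u_def row_stochastic_nonneg[OF P])
  also have "\<dots> = u $ j"
    using positive_part_invariant[OF P inv] unfolding u_def by (metis vector_matrix_mult_nth)
  finally show ?thesis by (simp add: u_def)
qed

lemma invariant_positive_accessible:
  fixes P :: "real ^ 's ^ 's::finite"
  assumes P: "row_stochastic P" and inv: "z v* P = z"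
    and acc: "accessible P i j" and i: "z $ i > 0"
  shows "z $ j > 0"
  using acc unfolding accessible_def
proof (induction rule: rtrancl_induct)
  case base
  show ?case by (fact i)
next
  case (step k l)
  then show ?case using invariant_positive_step[OF P inv] by blast
qed

section \<open>Uniqueness and existence of the stationary distribution\<close>

lemma accessible_refl: "accessible P i i"
  by (simp add: accessible_def)

lemma accessible_trans: "accessible P i j \<Longrightarrow> accessible P j k \<Longrightarrow> accessible P i k"
  unfolding accessible_def by (rule rtrancl_trans)

text \<open>Moving along the chain can only shrink the set of states that are still accessible, so a
  state accessible from \<open>i\<close> for which this set has least size is recurrent.\<close>

lemma recurrent_accessible:
  fixes P :: "real ^ 's ^ 's::finite"
  obtains k where "accessible P i k" "recurrent P k"
proof -
  define R where "R k = {j. accessible P k j}" for k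
  obtain k where k: "accessible P i k"
    and least: "\<And>l. accessible P i l \<Longrightarrow> card (R k) \<le> card (R l)"
    using ex_has_least_nat[of "accessible P i" i "\<lambda>k. card (R k)"] accessible_refl by blast
  have "accessible P j k" if kj: "accessible P k j" for j
  proof -
    have "R j \<subseteq> R k" using kj by (auto simp: R_def intro: accessible_trans)
    moreover have "card (R k) \<le> card (R j)" using accessible_trans[OF k kj] by (rule least)
    ultimately have "R j = R k" by (intro card_seteq) auto
    then show ?thesis using accessible_refl[of P k] by (auto simp: R_def)
  qed
  then show thesis using that k by (simp add: recurrent_def)
qed

lemma recurrent_class_where_invariant_positive:
  fixes P :: "real ^ 's ^ 's::finite"
  assumes P: "row_stochastic P" and inv: "z v* P = z" and i: "z $ i > 0"
  obtains C where "recurrent_class P C" "C \<noteq> {}" "\<And>j. j \<in> C \<Longrightarrow> z $ j > 0"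
proof -
  obtain k where ik: "accessible P i k" and k: "recurrent P k"
    by (rule recurrent_accessible)
  define C where "C = {j. accessible P k j \<and> accessible P j k}"
  have "recurrent_class P C" using k by (auto simp: recurrent_class_def C_def)
  moreover have "k \<in> C" by (simp add: C_def accessible_refl)
  moreover have "z $ j > 0" if "j \<in> C" for j
    using that invariant_positive_accessible[OF P inv _ i] accessible_trans[OF ik]
    by (auto simp: C_def)
  ultimately show thesis using that by blast
qed

lemma ex_pos_if_sum_zero:
  fixes z :: "real ^ 's::finite"
  assumes "(\<Sum>i\<in>UNIV. z $ i) = 0" "z \<noteq> 0"
  obtains i where "z $ i > 0"
proof (rule ccontr)
  assume "\<not> thesis"
  then have "\<And>i. z $ i \<le> 0" using that not_le by blast
  then have "\<And>i. z $ i = 0"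
    using assms(1) sum_nonneg_eq_0_iff[of UNIV "\<lambda>i. - z $ i"] by (simp add: sum_negf)
  then show False using assms(2) by (simp add: vec_eq_iff)
qed

lemma stationary_unique:
  fixes P :: "real ^ 's ^ 's::finite"
  assumes P: "row_stochastic P" and uni: "unichain P"
    and v: "stationary P v" and w: "stationary P w"
  shows "v = w"
proof (rule ccontr)
  define z where "z = v - w"
  assume "v \<noteq> w"
  then have nz: "z \<noteq> 0" "- z \<noteq> 0" by (auto simp: z_def)
  have inv: "z v* P = z" "(- z) v* P = - z"
    using v w
    by (auto simp: z_def stationary_def vec_eq_iff vector_matrix_mult_nth algebra_simps
        sum_subtractf sum_negf)
  have sum: "(\<Sum>i\<in>UNIV. z $ i) = 0" "(\<Sum>i\<in>UNIV. (- z) $ i) = 0"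
    using v w by (auto simp: z_def stationary_def sum_subtractf sum_negf)
  obtain i where "z $ i > 0" by (rule ex_pos_if_sum_zero[OF sum(1) nz(1)])
  from recurrent_class_where_invariant_positive[OF P inv(1) this]
  obtain C where C: "recurrent_class P C" "C \<noteq> {}" "\<And>j. j \<in> C \<Longrightarrow> z $ j > 0" by blast
  obtain i where "(- z) $ i > 0" by (rule ex_pos_if_sum_zero[OF sum(2) nz(2)])
  from recurrent_class_where_invariant_positive[OF P inv(2) this]
  obtain D where D: "recurrent_class P D" "\<And>j. j \<in> D \<Longrightarrow> (- z) $ j > 0" by blast
  have "C = D" using uni C(1) D(1) unfolding unichain_def by blast
  then show False using C(2,3) D(2) by force
qed

lemma stationary_exists:
  fixes P :: "real ^ 's ^ 's::finite"
  assumes P: "row_stochastic P"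
  shows "\<exists>v. stationary P v"
proof -
  define S :: "(real ^ 's) set" where "S = {v. (\<forall>i. v $ i \<ge> 0) \<and> (\<Sum>i\<in>UNIV. v $ i) = 1}"
  have "closed S"
    unfolding S_def
    by (intro closed_Collect_conj closed_Collect_all closed_Collect_le closed_Collect_eq
        continuous_intros)
  moreover have "bounded S"
  proof (rule boundedI)
    fix v assume "v \<in> S"
    then show "norm v \<le> 1" using norm_le_l1_cart[of v] by (simp add: S_def)
  qed
  ultimately have "compact S" by (simp add: compact_eq_bounded_closed)
  moreover have "convex S"
    by (rule convexI) (auto simp: S_def sum.distrib simp flip: sum_distrib_left)
  moreover have "S \<noteq> {}"
  proof -
    have "axis undefined 1 \<in> S" by (simp add: S_def axis_def)
    then show ?thesis by blast
  qed
  moreover have "continuous_on S (\<lambda>v. v v* P)"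
    unfolding vector_matrix_mult_def by (intro continuous_intros)
  moreover have "(\<lambda>v. v v* P) \<in> S \<rightarrow> S"
  proof
    fix v assume v: "v \<in> S"
    then have "(v v* P) $ j \<ge> 0" for j
      unfolding vector_matrix_mult_nth
      by (intro sum_nonneg mult_nonneg_nonneg) (auto simp: S_def row_stochastic_nonneg[OF P])
    then show "v v* P \<in> S" using v by (simp add: S_def sum_row_stochastic_mult[OF P])
  qed
  ultimately obtain v where "v \<in> S" "v v* P = v" by (rule brouwer)
  then show ?thesis by (auto simp: S_def stationary_def)
qed

lemma stationary_stationary_dist:
  fixes P :: "real ^ 's ^ 's::finite"
  assumes "row_stochastic P" "unichain P"
  shows "stationary P (stationary_dist P)"
  unfolding stationary_dist_def
  using stationary_exists[OF assms(1)] stationary_unique[OF assms] by (metis theI)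

section \<open>Variance and pseudo variance\<close>

lemma sum_steady_state:
  assumes "unichain (trans_matrix p d)"
  shows "(\<Sum>i\<in>UNIV. steady_state p d i) = 1"
  using stationary_stationary_dist[OF row_stochastic_trans_matrix assms]
  by (simp add: steady_state_def stationary_def)

text \<open>The parallel axis identity. The weights sum to one, so the constant \<open>y\<^sup>2 - m\<^sup>2\<close> in the
  expansion below survives with coefficient one.\<close>

lemma pseudo_variance_eq:
  assumes "unichain (trans_matrix p d)"
  shows "pseudo_variance p r y d = long_run_variance p r d + (long_run_mean p r d - y)\<^sup>2"
proof -
  define q where "q = steady_state p d"
  define m where "m = long_run_mean p r d"
  have q: "(\<Sum>i\<in>UNIV. q i) = 1" using sum_steady_state[OF assms] by (simp add: q_def)
  have m: "m = (\<Sum>i\<in>UNIV. q i * r i (d i))" by (simp add: m_def q_def long_run_mean_def)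
  have "(\<Sum>i\<in>UNIV. q i * (r i (d i) - y)\<^sup>2)
      = (\<Sum>i\<in>UNIV. q i * (r i (d i) - m)\<^sup>2 + 2 * (m - y) * (q i * r i (d i))
          + (y\<^sup>2 - m\<^sup>2) * q i)"
    by (intro sum.cong refl) (simp add: power2_eq_square algebra_simps)
  also have "\<dots> = (\<Sum>i\<in>UNIV. q i * (r i (d i) - m)\<^sup>2) + 2 * (m - y) * m + (y\<^sup>2 - m\<^sup>2)"
    by (simp add: sum.distrib q flip: sum_distrib_left m)
  also have "\<dots> = (\<Sum>i\<in>UNIV. q i * (r i (d i) - m)\<^sup>2) + (m - y)\<^sup>2"
    by (simp add: power2_eq_square algebra_simps)
  finally show ?thesis
    by (simp add: pseudo_variance_def long_run_variance_def q_def m_def)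
qed

theorem lemma4:
  fixes p :: "'s::finite \<Rightarrow> 'a::finite \<Rightarrow> 's pmf"
    and r :: "'s \<Rightarrow> 'a \<Rightarrow> real"
    and \<beta> y :: real
    and dopt d :: "'s \<Rightarrow> 'a"
  assumes unichain: "\<And>d'. unichain (trans_matrix p d')"
    and beta: "\<beta> \<ge> 0"
    and opt: "is_arg_min (\<lambda>d'. \<beta> * pseudo_variance p r y d' - long_run_mean p r d')
                (\<lambda>_. True) dopt"
    and mean: "long_run_mean p r d \<in>
                 {y - \<bar>y - long_run_mean p r dopt\<bar> .. y + \<bar>y - long_run_mean p r dopt\<bar>}"
  shows "\<beta> * long_run_variance p r dopt - long_run_mean p r dopt
           \<le> \<beta> * long_run_variance p r d - long_run_mean p r d"
proof -
  have "\<bar>long_run_mean p r d - y\<bar> \<le> \<bar>long_run_mean p r dopt - y\<bar>"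
    using mean by auto
  then have "(long_run_mean p r d - y)\<^sup>2 \<le> (long_run_mean p r dopt - y)\<^sup>2"
    by (simp add: abs_le_square_iff)
  then have "\<beta> * (long_run_mean p r d - y)\<^sup>2 \<le> \<beta> * (long_run_mean p r dopt - y)\<^sup>2"
    using beta by (rule mult_left_mono)
  moreover have "\<beta> * pseudo_variance p r y dopt - long_run_mean p r dopt
      \<le> \<beta> * pseudo_variance p r y d - long_run_mean p r d"
    using opt by (simp add: is_arg_min_linorder)
  ultimately show ?thesis
    by (simp add: pseudo_variance_eq[OF unichain] distrib_left)
qed

end
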